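(* Let $R$ be an associative ring with identity and let $n\ge 1$. The partial order $L_n(R)$ is a modular lattice with maximum and minimum elements.
   Context: For an associative, not necessarily commutative, ring $R$ with identity and $n\ge 1$, $L'_n(R)$ is the collection of pairs $(B\,|\,A)$ of matrices with entries in $R$ such that $A$ has $n$ columns and $B$ has the same number of rows as $A$ (the number of rows, and the number of columns of $B$, are arbitrary). The relation $(B\,|\,A)\le_n (B'\,|\,A')$ holds in $L'_n(R)$ if there exist matrices $U,V,G$ over $R$, of appropriate size, such that $UB=B'V$ and $UA=A'+B'G$. This is a pre-order; write $(B\,|\,A)\approx_n(B'\,|\,A')$ if both $(B\,|\,A)\le_n(B'\,|\,A')$ and $(B'\,|\,A')\le_n(B\,|\,A)$. $L_n(R)$ is the set of equivalence classes $[B\,|\,A]$ of $\approx_n$, with the induced partial order. A lattice with join $+$ and meet $\wedge$ is modular if $a\le b$ implies $(a+c)\wedge b=a+(b\wedge c)$. *)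

theory Defs
  imports "HOL-Algebra.Lattice" "Jordan_Normal_Form.Matrix"
begin

(* The sort {ring, monoid_mult} is that of associative, not necessarily commutative, rings with
   identity. The class ring_1 would in addition exclude the zero ring.
   A pair (B | A) is encoded as (B, A). Matrices may have zero rows or zero columns. *)

definition mat_pairs :: "nat \<Rightarrow> ('a :: {ring, monoid_mult} mat \<times> 'a mat) set" where
  "mat_pairs n = {(B, A). dim_col A = n \<and> dim_row B = dim_row A}"

(* Multiplication and addition in 'a mat are total, so the sizes are imposed by the carriers. *)
definition mat_pair_le ::
    "nat \<Rightarrow> 'a :: {ring, monoid_mult} mat \<times> 'a mat \<Rightarrow> 'a mat \<times> 'a mat \<Rightarrow> bool" where
  "mat_pair_le n = (\<lambda>(B, A) (B', A').
     \<exists>U \<in> carrier_mat (dim_row B') (dim_row B).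
     \<exists>V \<in> carrier_mat (dim_col B') (dim_col B).
     \<exists>G \<in> carrier_mat (dim_col B') n.
       U * B = B' * V \<and> U * A = A' + B' * G)"

definition mat_pair_equiv ::
    "nat \<Rightarrow> (('a :: {ring, monoid_mult} mat \<times> 'a mat) \<times> ('a mat \<times> 'a mat)) set" where
  "mat_pair_equiv n = {(p, q). p \<in> mat_pairs n \<and> q \<in> mat_pairs n \<and>
     mat_pair_le n p q \<and> mat_pair_le n q p}"

definition mat_pair_order :: "nat \<Rightarrow> ('a :: {ring, monoid_mult} mat \<times> 'a mat) set gorder" where
  "mat_pair_order n = \<lparr>carrier = mat_pairs n // mat_pair_equiv n, eq = (=),
     le = (\<lambda>X Y. \<exists>p \<in> X. \<exists>q \<in> Y. mat_pair_le n p q)\<rparr>"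

(* Lattice.lattice and Lattice.bounded_lattice are the carrier-based locales, as opposed to the
   type classes of the same names. *)
locale modular_lattice = Lattice.lattice +
  assumes modular: "\<lbrakk>a \<in> carrier L; b \<in> carrier L; c \<in> carrier L; a \<sqsubseteq> b\<rbrakk>
    \<Longrightarrow> (a \<squnion> c) \<sqinter> b = a \<squnion> (b \<sqinter> c)"

end

theory Submission
  imports Defs
begin

text \<open>
  A pair \<open>(B | A)\<close> stands for the positive primitive formula \<open>\<exists>y. B y = A x\<close> in an
  \<open>n\<close>-tuple \<open>x\<close> of elements of a left \<open>R\<close>-module. The solutions of such a formula in a given module
  form a subgroup of the group of all \<open>n\<close>-tuples, and the proof consists in showing that
  \<open>L\<^sub>n(R)\<close> is the lattice of these formulas, ordered by inclusion of their solution groups. It is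
  enough to look at finitely presented modules, and those are matrices again: a matrix \<open>P\<close> with
  \<open>k\<close> columns presents the quotient of \<open>R\<^sup>k\<close> by the row span of \<open>P\<close>.

  If \<open>U B = B' V\<close> and \<open>U A = A' + B' G\<close>, then \<open>B y = A x\<close> implies \<open>A' x = B' (V y - G x)\<close>, so
  the matrix relation yields inclusion of solutions (\<open>solutions_mono\<close>). Conversely, test
  the inclusion on the module whose generators are the unknowns \<open>y, x\<close> and whose relations are the
  rows of \<open>B y = A x\<close>; the tuple of generators \<open>x\<close> solves \<open>(B | A)\<close> there, and a witness that it
  also solves \<open>(B' | A')\<close> consists of exactly the matrices \<open>U\<close>, \<open>V\<close>, \<open>G\<close> up to sign
  (\<open>mat_pair_leI_solutions\<close>).

  After this translation block matrices are needed for only one purpose, to see that conjunction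
  has the intersection as its solutions (\<open>solutions_meet\<close>) and that the formula ``\<open>x\<close> is a sum of
  two solutions'' has the sum of the groups as its solutions (\<open>solutions_join\<close>). The lattice laws,
  and above all the modular law (\<open>solutions_modular\<close>), are then those of subgroups of an abelian
  group: if \<open>x\<^sub>1 + x\<^sub>2\<close> and \<open>x\<^sub>1\<close> solve \<open>b\<close>, so does \<open>x\<^sub>2\<close>. The always true formula is the maximum,
  and \<open>x = 0\<close> is the minimum.
\<close>

section \<open>Block matrices\<close>

text \<open>
  In the sort used here the ring may be trivial, which the class \<open>semiring_1\<close> excludes; the unit
  laws for matrices nevertheless hold.
\<close>
lemma mat_mult_one [simp]:
  fixes A :: "'a :: {ring, monoid_mult} mat"
  shows "A \<in> carrier_mat m k \<Longrightarrow> A * 1\<^sub>m k = A" and "A \<in> carrier_mat m k \<Longrightarrow> 1\<^sub>m m * A = A"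
  by (auto intro!: eq_matI simp: scalar_prod_def one_mat_def if_distrib if_distribR sum.delta sum.delta' cong: if_cong)

definition append_cols :: "'a :: zero mat \<Rightarrow> 'a mat \<Rightarrow> 'a mat" (infixr \<open>@\<^sub>c\<close> 65) where
  "A @\<^sub>c B = four_block_mat A B (0\<^sub>m 0 (dim_col A)) (0\<^sub>m 0 (dim_col B))"

lemma append_cols_carrier [simp, intro]:
  "A \<in> carrier_mat m k \<Longrightarrow> B \<in> carrier_mat m l \<Longrightarrow> A @\<^sub>c B \<in> carrier_mat m (k + l)"
  by (auto simp: append_cols_def)

lemma mult_append_cols:
  assumes "A \<in> carrier_mat r m" "B \<in> carrier_mat m k" "C \<in> carrier_mat m l"
  shows "A * (B @\<^sub>c C) = A * B @\<^sub>c A * C"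
  using assms
  by (intro eq_matI) (auto simp: append_cols_def scalar_prod_def intro!: sum.cong)

lemma add_append_cols:
  assumes "A \<in> carrier_mat m k" "C \<in> carrier_mat m k" "B \<in> carrier_mat m l" "D \<in> carrier_mat m l"
  shows "(A @\<^sub>c B) + (C @\<^sub>c D) = (A + C) @\<^sub>c (B + D)"
  using assms by (intro eq_matI) (auto simp: append_cols_def)

lemma append_cols_inject:
  assumes "A @\<^sub>c B = C @\<^sub>c D"
    and "A \<in> carrier_mat m k" "C \<in> carrier_mat m k" "B \<in> carrier_mat m l" "D \<in> carrier_mat m l"
  shows "A = C \<and> B = D"
proof -
  have e: "(A @\<^sub>c B) $$ (i, j) = (C @\<^sub>c D) $$ (i, j)" for i j
    using assms(1) by simp
  show ?thesis
  proof (intro conjI eq_matI)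
    fix i j assume "i < dim_row C" "j < dim_col C"
    then show "A $$ (i, j) = C $$ (i, j)" using e[of i j] assms by (auto simp: append_cols_def)
  next
    fix i j assume "i < dim_row D" "j < dim_col D"
    then show "B $$ (i, j) = D $$ (i, j)" using e[of i "k + j"] assms by (auto simp: append_cols_def)
  qed (use assms in auto)
qed

lemma append_cols_cases:
  assumes "A \<in> carrier_mat m (k + l)"
  obtains B C where "B \<in> carrier_mat m k" "C \<in> carrier_mat m l" "A = B @\<^sub>c C"
proof
  show "A = mat m k (\<lambda>(i, j). A $$ (i, j)) @\<^sub>c mat m l (\<lambda>(i, j). A $$ (i, k + j))"
    using assms by (intro eq_matI) (auto simp: append_cols_def)
qed auto

lemma append_rows_mult:
  assumes "A \<in> carrier_mat k m" "B \<in> carrier_mat l m" "C \<in> carrier_mat m r"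
  shows "(A @\<^sub>r B) * C = A * C @\<^sub>r B * C"
  using assms
  by (intro eq_matI) (auto simp: append_rows_def scalar_prod_def intro!: sum.cong)

lemma add_append_rows:
  assumes "A \<in> carrier_mat k m" "C \<in> carrier_mat k m" "B \<in> carrier_mat l m" "D \<in> carrier_mat l m"
  shows "(A @\<^sub>r B) + (C @\<^sub>r D) = (A + C) @\<^sub>r (B + D)"
  using assms by (intro eq_matI) (auto simp: append_rows_def)

lemma append_rows_eq_iff:
  assumes "A \<in> carrier_mat k m" "C \<in> carrier_mat k m" "B \<in> carrier_mat l m" "D \<in> carrier_mat l m"
  shows "A @\<^sub>r B = C @\<^sub>r D \<longleftrightarrow> A = C \<and> B = D"
proof
  assume "A @\<^sub>r B = C @\<^sub>r D"
  then have e: "(A @\<^sub>r B) $$ (i, j) = (C @\<^sub>r D) $$ (i, j)" for i j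
    by simp
  show "A = C \<and> B = D"
  proof (intro conjI eq_matI)
    fix i j assume "i < dim_row C" "j < dim_col C"
    then show "A $$ (i, j) = C $$ (i, j)" using e[of i j] assms by (auto simp: append_rows_def)
  next
    fix i j assume "i < dim_row D" "j < dim_col D"
    then show "B $$ (i, j) = D $$ (i, j)" using e[of "k + i" j] assms by (auto simp: append_rows_def)
  qed (use assms in auto)
qed auto

lemma append_rows_cases:
  assumes "A \<in> carrier_mat (k + l) m"
  obtains B C where "B \<in> carrier_mat k m" "C \<in> carrier_mat l m" "A = B @\<^sub>r C"
proof
  show "A = mat k m (\<lambda>(i, j). A $$ (i, j)) @\<^sub>r mat l m (\<lambda>(i, j). A $$ (k + i, j))"
    using assms by (intro eq_matI) (auto simp: append_rows_def)
qed auto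

text \<open>
  Stacking is the case of a \<open>2 \<times> 2\<close> block matrix whose second block column has width zero, so
  this is an instance of the multiplication of block matrices.
\<close>
lemma four_block_mult_append_rows:
  fixes A :: "'a :: semiring_0 mat"
  assumes "A \<in> carrier_mat r1 c1" "B \<in> carrier_mat r1 c2" "C \<in> carrier_mat r2 c1" "D \<in> carrier_mat r2 c2"
    and "X \<in> carrier_mat c1 m" "Y \<in> carrier_mat c2 m"
  shows "four_block_mat A B C D * (X @\<^sub>r Y) = (A * X + B * Y) @\<^sub>r (C * X + D * Y)"
proof -
  have "four_block_mat A B C D * four_block_mat X (0\<^sub>m c1 0) Y (0\<^sub>m c2 0)
    = four_block_mat (A * X + B * Y) (A * 0\<^sub>m c1 0 + B * 0\<^sub>m c2 0)
        (C * X + D * Y) (C * 0\<^sub>m c1 0 + D * 0\<^sub>m c2 0)"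
    using assms by (intro mult_four_block_mat[where ?nr1.0 = r1 and ?nr2.0 = r2 and ?n1.0 = c1 and ?n2.0 = c2
        and ?nc1.0 = m and ?nc2.0 = 0]) auto
  then show ?thesis using assms by (auto simp: append_rows_def)
qed

lemma append_cols_mult_append_rows:
  fixes A :: "'a :: semiring_0 mat"
  assumes "A \<in> carrier_mat r c1" "B \<in> carrier_mat r c2"
    and "X \<in> carrier_mat c1 m" "Y \<in> carrier_mat c2 m"
  shows "(A @\<^sub>c B) * (X @\<^sub>r Y) = A * X + B * Y"
proof -
  have "four_block_mat A B (0\<^sub>m 0 c1) (0\<^sub>m 0 c2) * (X @\<^sub>r Y) = (A * X + B * Y) @\<^sub>r
    (0\<^sub>m 0 c1 * X + 0\<^sub>m 0 c2 * Y)"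
    using assms by (intro four_block_mult_append_rows[where ?r1.0 = r and ?r2.0 = 0]) auto
  also have "\<dots> = A * X + B * Y"
    using assms by (intro eq_matI) (auto simp: append_rows_def)
  finally show ?thesis using assms by (auto simp: append_cols_def)
qed

section \<open>Solutions in finitely presented modules\<close>

text \<open>
  The rows of \<open>X\<close> represent an \<open>n\<close>-tuple of elements of the left module presented by \<open>P\<close>, and
  \<open>Y\<close> represents the existentially quantified tuple. Two representatives are equal in the module
  if they differ by a combination \<open>W * P\<close> of the relations, so the condition reads
  \<open>A x = B y\<close> in the module.
\<close>
definition solutions ::
    "'a :: {ring, monoid_mult} mat \<times> 'a mat \<Rightarrow> 'a mat \<Rightarrow> 'a mat set" where
  "solutions = (\<lambda>(B, A) P. {X \<in> carrier_mat (dim_col A) (dim_col P).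
     \<exists>Y \<in> carrier_mat (dim_col B) (dim_col P). \<exists>W \<in> carrier_mat (dim_row B) (dim_row P).
       A * X = B * Y + W * P})"

lemma solutions_eq:
  assumes "B \<in> carrier_mat m c" "A \<in> carrier_mat m n" "P \<in> carrier_mat s k"
  shows "solutions (B, A) P = {X \<in> carrier_mat n k. \<exists>Y \<in> carrier_mat c k.
     \<exists>W \<in> carrier_mat m s. A * X = B * Y + W * P}"
  using assms unfolding solutions_def by auto

lemma solutionsI:
  assumes "B \<in> carrier_mat m c" "A \<in> carrier_mat m n" "P \<in> carrier_mat s k"
    and "X \<in> carrier_mat n k" "Y \<in> carrier_mat c k" "W \<in> carrier_mat m s" "A * X = B * Y + W * P"
  shows "X \<in> solutions (B, A) P"
  unfolding solutions_eq[OF assms(1-3)] using assms(4-) by blast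

lemma solutions_carrier: "p \<in> mat_pairs n \<Longrightarrow> X \<in> solutions p P \<Longrightarrow> X \<in> carrier_mat n (dim_col P)"
  by (auto simp: solutions_def mat_pairs_def)

lemma mat_pairsE:
  assumes "p \<in> mat_pairs n"
  obtains m c B A where "p = (B, A)" "B \<in> carrier_mat m c" "A \<in> carrier_mat m n"
  using assms by (cases p) (auto simp: mat_pairs_def)

text \<open>
  The test module is the free realization of \<open>p\<close>: generators \<open>y, x\<close> and relations
  \<open>B y - A x = 0\<close>, that is, the matrix \<open>(B | -A)\<close>. The tuple \<open>x\<close> of generators, whose matrix is
  \<open>(0 | 1)\<close>, solves \<open>p\<close> and hence \<open>q\<close>. Comparing the two column blocks in
  \<open>A' (0 | 1) = B' (V | G) + W (B | -A)\<close> gives the required equations with \<open>U = -W\<close> and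
  \<open>-G\<close> for \<open>G\<close>.
\<close>
lemma mat_pair_leI_solutions:
  assumes p: "p \<in> mat_pairs n" and q: "q \<in> mat_pairs n"
    and sub: "\<And>P. solutions p P \<subseteq> solutions q P"
  shows "mat_pair_le n p q"
proof -
  obtain m c B A where pp: "p = (B, A)" and B: "B \<in> carrier_mat m c" and A: "A \<in> carrier_mat m n"
    using p by (rule mat_pairsE)
  obtain m' c' B' A' where qq: "q = (B', A')" and B': "B' \<in> carrier_mat m' c'"
    and A': "A' \<in> carrier_mat m' n"
    using q by (rule mat_pairsE)
  define P where "P = B @\<^sub>c (- A)"
  define X where "X = 0\<^sub>m n c @\<^sub>c (1\<^sub>m n :: 'a mat)"
  have P: "P \<in> carrier_mat m (c + n)" and X: "X \<in> carrier_mat n (c + n)"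
    using A B by (auto simp: P_def X_def)
  \<comment> \<open>The generators \<open>y\<close>, with matrix \<open>(1 | 0)\<close>, witness the existential quantifier; the factor
    \<open>-1\<close> makes up for the sign of the relations.\<close>
  have "A * X = B * (1\<^sub>m c @\<^sub>c 0\<^sub>m c n) + (- 1\<^sub>m m) * P"
  proof -
    have "- 1\<^sub>m m * P = - B @\<^sub>c A"
      using A B unfolding P_def
      by (subst mult_append_cols[of _ m m _ c _ n]) auto
    moreover have "B * (1\<^sub>m c @\<^sub>c 0\<^sub>m c n) = B @\<^sub>c 0\<^sub>m m n"
      using B by (subst mult_append_cols[of _ m c _ c _ n]) auto
    moreover have "A * X = 0\<^sub>m m c @\<^sub>c A"
      using A unfolding X_def by (subst mult_append_cols[of _ m n _ c _ n]) auto
    moreover have "B + - B = 0\<^sub>m m c"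
      using B by (intro eq_matI) auto
    then have "(B @\<^sub>c 0\<^sub>m m n) + (- B @\<^sub>c A) = 0\<^sub>m m c @\<^sub>c A"
      using A B by (subst add_append_cols[of _ m c _ _ n]) auto
    ultimately show ?thesis by simp
  qed
  moreover have "1\<^sub>m c @\<^sub>c 0\<^sub>m c n \<in> carrier_mat c (c + n)" by auto
  moreover have "- 1\<^sub>m m \<in> carrier_mat m m" by auto
  ultimately have "X \<in> solutions p P"
    using X unfolding pp solutions_eq[OF B A P] by blast
  then have "X \<in> solutions q P" using sub by blast
  then obtain Y W where Y: "Y \<in> carrier_mat c' (c + n)" and W: "W \<in> carrier_mat m' m"
    and e: "A' * X = B' * Y + W * P"
    unfolding qq solutions_eq[OF B' A' P] by blast
  obtain V G where V: "V \<in> carrier_mat c' c" and G: "G \<in> carrier_mat c' n" and YVG: "Y = V @\<^sub>c G"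
    using Y by (rule append_cols_cases)
  have "A' * X = 0\<^sub>m m' c @\<^sub>c A'"
    using A' unfolding X_def by (subst mult_append_cols[of _ m' n _ c _ n]) auto
  moreover have "B' * Y = B' * V @\<^sub>c B' * G"
    unfolding YVG using mult_append_cols[OF B' V G] .
  moreover have "W * P = W * B @\<^sub>c - (W * A)"
    unfolding P_def using A B W by (subst mult_append_cols[of _ m' m _ c _ n]) auto
  moreover have "(B' * V @\<^sub>c B' * G) + (W * B @\<^sub>c - (W * A)) = (B' * V + W * B) @\<^sub>c (B' * G + - (W * A))"
    by (rule add_append_cols[of _ m' c _ _ n]) (use A B W V G B' in auto)
  ultimately have "0\<^sub>m m' c @\<^sub>c A' = (B' * V + W * B) @\<^sub>c (B' * G + - (W * A))"
    using e by simp
  then have "0\<^sub>m m' c = B' * V + W * B \<and> A' = B' * G + - (W * A)"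
    by (rule append_cols_inject[of _ _ _ _ m' c n]) (use A B W V G B' A' in auto)
  then have e1: "0\<^sub>m m' c = B' * V + W * B" and e2: "A' = B' * G + - (W * A)" by auto
  have "(- W) * B = B' * V"
  proof (rule eq_matI)
    fix i j assume ij: "i < dim_row (B' * V)" "j < dim_col (B' * V)"
    then have "(0\<^sub>m m' c) $$ (i, j) = (B' * V + W * B) $$ (i, j)" using e1 by simp
    then show "((- W) * B) $$ (i, j) = (B' * V) $$ (i, j)"
      using ij B B' V W by (simp add: neg_eq_iff_add_eq_0 add.commute)
  qed (use B B' V W in auto)
  moreover have "(- W) * A = A' + B' * (- G)"
    using A A' B' G W by (subst e2) (auto intro!: eq_matI)
  moreover have "- W \<in> carrier_mat m' m" "- G \<in> carrier_mat c' n" using W G by auto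
  ultimately have "\<exists>U \<in> carrier_mat m' m. \<exists>V \<in> carrier_mat c' c. \<exists>G \<in> carrier_mat c' n.
      U * B = B' * V \<and> U * A = A' + B' * G"
    using V by blast
  then show ?thesis
    using B B' by (simp add: mat_pair_le_def pp qq)
qed

text \<open>
  A witness \<open>y\<close> for \<open>p\<close> becomes the witness \<open>V y - G x\<close> for \<open>q\<close>.
\<close>
lemma solutions_mono:
  assumes p: "p \<in> mat_pairs n" and q: "q \<in> mat_pairs n" and le: "mat_pair_le n p q"
  shows "solutions p P \<subseteq> solutions q P"
proof
  fix X assume X: "X \<in> solutions p P"
  obtain m c B A where pp: "p = (B, A)" and B: "B \<in> carrier_mat m c" and A: "A \<in> carrier_mat m n"
    using p by (rule mat_pairsE)
  obtain m' c' B' A' where qq: "q = (B', A')" and B': "B' \<in> carrier_mat m' c'"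
    and A': "A' \<in> carrier_mat m' n"
    using q by (rule mat_pairsE)
  obtain U V G where U: "U \<in> carrier_mat m' m" and V: "V \<in> carrier_mat c' c"
    and G: "G \<in> carrier_mat c' n" and e1: "U * B = B' * V" and e2: "U * A = A' + B' * G"
    using le B B' unfolding mat_pair_le_def pp qq by auto
  obtain s k where P: "P \<in> carrier_mat s k" by blast
  obtain Y W where XC: "X \<in> carrier_mat n k" and Y: "Y \<in> carrier_mat c k"
    and W: "W \<in> carrier_mat m s" and e: "A * X = B * Y + W * P"
    using X unfolding pp solutions_eq[OF B A P] by blast
  have "A' * X + B' * (G * X) = (A' + B' * G) * X"
    using A' B' G XC by (subst add_mult_distrib_mat[of _ m' n]) auto
  also have "\<dots> = U * (A * X)"
    unfolding e2[symmetric] using U A XC by auto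
  also have "\<dots> = U * (B * Y) + U * (W * P)"
    unfolding e using U B Y W P by (subst mult_add_distrib_mat[of _ m' m _ k]) auto
  also have "\<dots> = B' * (V * Y) + (U * W) * P"
    using U B Y W P V B' e1 assoc_mult_mat[OF U B Y] by auto
  finally have f: "A' * X + B' * (G * X) = B' * (V * Y) + (U * W) * P" .
  have "A' * X = B' * (V * Y - G * X) + (U * W) * P"
  proof (rule eq_matI)
    fix i j assume ij: "i < dim_row (B' * (V * Y - G * X) + (U * W) * P)"
      "j < dim_col (B' * (V * Y - G * X) + (U * W) * P)"
    have "(A' * X + B' * (G * X)) $$ (i, j) = (B' * (V * Y) + (U * W) * P) $$ (i, j)"
      using f by simp
    moreover have "B' * (V * Y - G * X) = B' * (V * Y) - B' * (G * X)"
      using B' V Y G XC by (intro mult_minus_distrib_mat[of _ m' c' _ k]) auto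
    ultimately show "(A' * X) $$ (i, j) = (B' * (V * Y - G * X) + (U * W) * P) $$ (i, j)"
      using ij A' XC B' V Y G U W P by (auto simp: algebra_simps simp del: assoc_mult_mat)
  qed (use A' XC B' P U in auto)
  moreover have "V * Y - G * X \<in> carrier_mat c' k" "U * W \<in> carrier_mat m' s"
    using V Y G XC U W by auto
  ultimately show "X \<in> solutions q P"
    unfolding qq using XC by (intro solutionsI[OF B' A' P])
qed

text \<open>
  From here on the matrix relation is used only through this equivalence. In particular, it shows
  that the relation is a preorder.
\<close>
lemma mat_pair_le_iff_solutions:
  assumes "p \<in> mat_pairs n" "q \<in> mat_pairs n"
  shows "mat_pair_le n p q \<longleftrightarrow> (\<forall>P. solutions p P \<subseteq> solutions q P)"
  using assms mat_pair_leI_solutions solutions_mono by blast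

text \<open>
  Differences of witnesses are witnesses of differences; this is where the solutions become a
  group, as the modular law demands.
\<close>
lemma solutions_diff:
  assumes p: "p \<in> mat_pairs n" and X: "X \<in> solutions p P" and X': "X' \<in> solutions p P"
  shows "X - X' \<in> solutions p P"
proof -
  obtain m c B A where pp: "p = (B, A)" and B: "B \<in> carrier_mat m c" and A: "A \<in> carrier_mat m n"
    using p by (rule mat_pairsE)
  obtain s k where P: "P \<in> carrier_mat s k" by blast
  obtain Y W where XC: "X \<in> carrier_mat n k" and Y: "Y \<in> carrier_mat c k"
    and W: "W \<in> carrier_mat m s" and e: "A * X = B * Y + W * P"
    using X unfolding pp solutions_eq[OF B A P] by blast
  obtain Y' W' where XC': "X' \<in> carrier_mat n k" and Y': "Y' \<in> carrier_mat c k"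
    and W': "W' \<in> carrier_mat m s" and e': "A * X' = B * Y' + W' * P"
    using X' unfolding pp solutions_eq[OF B A P] by blast
  have "A * (X - X') = A * X - A * X'"
    using A XC XC' by (rule mult_minus_distrib_mat)
  also have "\<dots> = (B * Y - B * Y') + (W * P - W' * P)"
    unfolding e e' using B Y Y' W W' P by (intro eq_matI) auto
  also have "\<dots> = B * (Y - Y') + (W - W') * P"
    using mult_minus_distrib_mat[OF B Y Y'] minus_mult_distrib_mat[OF W W' P] by simp
  finally have e: "A * (X - X') = B * (Y - Y') + (W - W') * P" .
  have "X - X' \<in> carrier_mat n k" "Y - Y' \<in> carrier_mat c k" "W - W' \<in> carrier_mat m s"
    using XC XC' Y Y' W W' by auto
  then show ?thesis
    unfolding pp using e by (rule solutionsI[OF B A P])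
qed

text \<open>
  Combinations of relations represent the zero tuple, which solves every formula.
\<close>
lemma relations_in_solutions:
  assumes p: "p \<in> mat_pairs n" and W: "W \<in> carrier_mat n (dim_row P)"
  shows "W * P \<in> solutions p P"
proof -
  obtain m c B A where pp: "p = (B, A)" and B: "B \<in> carrier_mat m c" and A: "A \<in> carrier_mat m n"
    using p by (rule mat_pairsE)
  obtain s k where P: "P \<in> carrier_mat s k" by blast
  have W': "W \<in> carrier_mat n s" using W P by auto
  have e: "A * (W * P) = B * 0\<^sub>m c k + (A * W) * P"
    using A B W' P by auto
  have "W * P \<in> carrier_mat n k" "0\<^sub>m c k \<in> carrier_mat c k" "A * W \<in> carrier_mat m s"
    using A W' P by auto
  then show ?thesis
    unfolding pp using e by (rule solutionsI[OF B A P])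
qed

lemma zero_in_solutions:
  assumes "p \<in> mat_pairs n"
  shows "0\<^sub>m n (dim_col P) \<in> solutions p P"
  using relations_in_solutions[OF assms, of "0\<^sub>m n (dim_row P)" P] by simp

lemma solutions_add:
  assumes p: "p \<in> mat_pairs n" and X: "X \<in> solutions p P" and X': "X' \<in> solutions p P"
  shows "X + X' \<in> solutions p P"
proof -
  have c: "X \<in> carrier_mat n (dim_col P)" "X' \<in> carrier_mat n (dim_col P)"
    using solutions_carrier[OF p] X X' by blast+
  have "X - (0\<^sub>m n (dim_col P) - X') \<in> solutions p P"
    by (intro solutions_diff[OF p] zero_in_solutions[OF p] X X')
  moreover have "X - (0\<^sub>m n (dim_col P) - X') = X + X'"
    using c by (intro eq_matI) auto
  ultimately show ?thesis by simp
qed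

section \<open>Lattice operations on formulas\<close>

text \<open>The empty system of equations, which every tuple solves.\<close>
definition pair_top :: "nat \<Rightarrow> 'a :: {ring, monoid_mult} mat \<times> 'a mat" where
  "pair_top n = (0\<^sub>m 0 0, 0\<^sub>m 0 n)"

text \<open>The formula \<open>x = 0\<close>: there is no quantified variable.\<close>
definition pair_bot :: "nat \<Rightarrow> 'a :: {ring, monoid_mult} mat \<times> 'a mat" where
  "pair_bot n = (0\<^sub>m n 0, 1\<^sub>m n)"

text \<open>The conjunction, with separate quantified variables for the two conjuncts.\<close>
definition pair_meet ::
    "'a :: {ring, monoid_mult} mat \<times> 'a mat \<Rightarrow> 'a mat \<times> 'a mat \<Rightarrow> 'a mat \<times> 'a mat" where
  "pair_meet = (\<lambda>(B, A) (B', A').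
     (four_block_mat B (0\<^sub>m (dim_row B) (dim_col B')) (0\<^sub>m (dim_row B') (dim_col B)) B', A @\<^sub>r A'))"

text \<open>
  The formula ``\<open>x\<close> is a sum of a solution \<open>x\<^sub>1\<close> of \<open>(B | A)\<close> and a solution of \<open>(B' | A')\<close>''. The
  quantified variables are \<open>y\<close>, \<open>x\<^sub>1\<close>, \<open>y'\<close> in this order, and the equations are
  \<open>B y - A x\<^sub>1 = 0\<close> and \<open>A' x\<^sub>1 + B' y' = A' x\<close>; the second one says that \<open>x - x\<^sub>1\<close> solves
  \<open>(B' | A')\<close>.
\<close>
definition pair_join ::
    "'a :: {ring, monoid_mult} mat \<times> 'a mat \<Rightarrow> 'a mat \<times> 'a mat \<Rightarrow> 'a mat \<times> 'a mat" where
  "pair_join = (\<lambda>(B, A) (B', A').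
     (four_block_mat (B @\<^sub>c - A) (0\<^sub>m (dim_row B) (dim_col B'))
        (0\<^sub>m (dim_row B') (dim_col B) @\<^sub>c A') B',
      0\<^sub>m (dim_row A) (dim_col A) @\<^sub>r A'))"

lemma pair_top_in [simp]: "pair_top n \<in> mat_pairs n"
  by (simp add: pair_top_def mat_pairs_def)

lemma pair_bot_in [simp]: "pair_bot n \<in> mat_pairs n"
  by (simp add: pair_bot_def mat_pairs_def)

lemma pair_meet_in [simp]:
  "p \<in> mat_pairs n \<Longrightarrow> q \<in> mat_pairs n \<Longrightarrow> pair_meet p q \<in> mat_pairs n"
  by (auto simp: pair_meet_def mat_pairs_def append_rows_def)

lemma pair_join_in [simp]:
  "p \<in> mat_pairs n \<Longrightarrow> q \<in> mat_pairs n \<Longrightarrow> pair_join p q \<in> mat_pairs n"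
  by (auto simp: pair_join_def mat_pairs_def append_rows_def append_cols_def)

lemma solutions_top: "solutions (pair_top n) P = carrier_mat n (dim_col P)"
proof (intro equalityI subsetI)
  fix X assume "X \<in> solutions (pair_top n) P"
  then show "X \<in> carrier_mat n (dim_col P)"
    by (rule solutions_carrier[OF pair_top_in])
next
  fix X :: "'a mat" assume X: "X \<in> carrier_mat n (dim_col P)"
  then have e: "0\<^sub>m 0 n * X = 0\<^sub>m 0 0 * 0\<^sub>m 0 (dim_col P) + 0\<^sub>m 0 (dim_row P) * P"
    by (intro eq_matI) auto
  have P: "P \<in> carrier_mat (dim_row P) (dim_col P)" by simp
  show "X \<in> solutions (pair_top n) P"
    unfolding pair_top_def
    by (rule solutionsI[where m = 0 and c = 0, OF _ _ P X _ _ e]) simp_all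
qed

lemma solutions_bot:
  "solutions (pair_bot n) P = {W * P | W. W \<in> carrier_mat n (dim_row P)}"
proof (intro equalityI subsetI)
  fix X assume "X \<in> solutions (pair_bot n) P"
  then obtain Y W where "X \<in> carrier_mat n (dim_col P)" "Y \<in> carrier_mat 0 (dim_col P)"
      "W \<in> carrier_mat n (dim_row P)" "1\<^sub>m n * X = 0\<^sub>m n 0 * Y + W * P"
    by (auto simp: pair_bot_def solutions_def)
  moreover from this have "0\<^sub>m n 0 * Y + W * P = W * P"
    by (intro eq_matI) auto
  ultimately show "X \<in> {W * P | W. W \<in> carrier_mat n (dim_row P)}" by auto
next
  fix X assume "X \<in> {W * P | W. W \<in> carrier_mat n (dim_row P)}"
  then show "X \<in> solutions (pair_bot n) P"
    using relations_in_solutions[OF pair_bot_in] by blast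
qed

lemma solutions_meet:
  assumes p: "p \<in> mat_pairs n" and q: "q \<in> mat_pairs n"
  shows "solutions (pair_meet p q) P = solutions p P \<inter> solutions q P"
proof -
  obtain m c B A where pp: "p = (B, A)" and B: "B \<in> carrier_mat m c" and A: "A \<in> carrier_mat m n"
    using p by (rule mat_pairsE)
  obtain m' c' B' A' where qq: "q = (B', A')" and B': "B' \<in> carrier_mat m' c'"
    and A': "A' \<in> carrier_mat m' n"
    using q by (rule mat_pairsE)
  obtain s k where P: "P \<in> carrier_mat s k" by blast
  let ?M = "four_block_mat B (0\<^sub>m m c') (0\<^sub>m m' c) B'"
  have M: "?M \<in> carrier_mat (m + m') (c + c')" using B B' by auto
  have AA: "A @\<^sub>r A' \<in> carrier_mat (m + m') n" using A A' by auto
  have meet: "pair_meet p q = (?M, A @\<^sub>r A')"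
    using B B' by (simp add: pair_meet_def pp qq)
  have key: "(A @\<^sub>r A') * X = ?M * (Y @\<^sub>r Y') + (W @\<^sub>r W') * P \<longleftrightarrow>
      A * X = B * Y + W * P \<and> A' * X = B' * Y' + W' * P"
    if X: "X \<in> carrier_mat n k" and Y: "Y \<in> carrier_mat c k" and Y': "Y' \<in> carrier_mat c' k"
      and W: "W \<in> carrier_mat m s" and W': "W' \<in> carrier_mat m' s" for X Y Y' W W'
  proof -
    have "?M * (Y @\<^sub>r Y') = (B * Y + 0\<^sub>m m c' * Y') @\<^sub>r (0\<^sub>m m' c * Y + B' * Y')"
      using B B' Y Y' by (intro four_block_mult_append_rows) auto
    also have "\<dots> = B * Y @\<^sub>r B' * Y'"
      using B B' Y Y' by simp
    finally have "?M * (Y @\<^sub>r Y') + (W @\<^sub>r W') * P = (B * Y + W * P) @\<^sub>r (B' * Y' + W' * P)"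
      using B B' Y Y' W W' P append_rows_mult[OF W W' P]
        add_append_rows[of "B * Y" m k "W * P" "B' * Y'" m' "W' * P"] by auto
    then show ?thesis
      using append_rows_mult[OF A A' X] A A' X B B' Y Y' W W' P
      by (auto simp: append_rows_eq_iff[of _ m k _ _ m'])
  qed
  show ?thesis
  proof (intro equalityI subsetI)
    fix X assume "X \<in> solutions (pair_meet p q) P"
    then obtain YY WW where X: "X \<in> carrier_mat n k" and YY: "YY \<in> carrier_mat (c + c') k"
      and WW: "WW \<in> carrier_mat (m + m') s" and e: "(A @\<^sub>r A') * X = ?M * YY + WW * P"
      unfolding meet solutions_eq[OF M AA P] by blast
    obtain Y Y' where Y: "Y \<in> carrier_mat c k" "Y' \<in> carrier_mat c' k" "YY = Y @\<^sub>r Y'"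
      using YY by (rule append_rows_cases)
    obtain W W' where W: "W \<in> carrier_mat m s" "W' \<in> carrier_mat m' s" "WW = W @\<^sub>r W'"
      using WW by (rule append_rows_cases)
    show "X \<in> solutions p P \<inter> solutions q P"
      using X Y W e key[OF X Y(1,2) W(1,2)]
      unfolding pp qq solutions_eq[OF B A P] solutions_eq[OF B' A' P] by blast
  next
    fix X assume "X \<in> solutions p P \<inter> solutions q P"
    then obtain Y Y' W W' where "X \<in> carrier_mat n k" "Y \<in> carrier_mat c k" "Y' \<in> carrier_mat c' k"
      "W \<in> carrier_mat m s" "W' \<in> carrier_mat m' s"
      "A * X = B * Y + W * P" "A' * X = B' * Y' + W' * P"
      unfolding pp qq solutions_eq[OF B A P] solutions_eq[OF B' A' P] by blast
    then have "X \<in> carrier_mat n k" "(A @\<^sub>r A') * X = ?M * (Y @\<^sub>r Y') + (W @\<^sub>r W') * P"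
      "Y @\<^sub>r Y' \<in> carrier_mat (c + c') k" "W @\<^sub>r W' \<in> carrier_mat (m + m') s"
      using key by auto
    then show "X \<in> solutions (pair_meet p q) P"
      unfolding meet solutions_eq[OF M AA P] by blast
  qed
qed

text \<open>
  A witness for the join splits into its blocks \<open>y\<close>, \<open>x\<^sub>1\<close>, \<open>y'\<close>, which show that \<open>x\<^sub>1\<close> solves
  \<open>p\<close> and \<open>x - x\<^sub>1\<close> solves \<open>q\<close>; stacking the blocks gives the converse.
\<close>
lemma solutions_join:
  assumes p: "p \<in> mat_pairs n" and q: "q \<in> mat_pairs n"
  shows "solutions (pair_join p q) P = {X + X' | X X'. X \<in> solutions p P \<and> X' \<in> solutions q P}"
proof -
  obtain m c B A where pp: "p = (B, A)" and B: "B \<in> carrier_mat m c" and A: "A \<in> carrier_mat m n"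
    using p by (rule mat_pairsE)
  obtain m' c' B' A' where qq: "q = (B', A')" and B': "B' \<in> carrier_mat m' c'"
    and A': "A' \<in> carrier_mat m' n"
    using q by (rule mat_pairsE)
  obtain s k where P: "P \<in> carrier_mat s k" by blast
  let ?M = "four_block_mat (B @\<^sub>c - A) (0\<^sub>m m c') (0\<^sub>m m' c @\<^sub>c A') B'"
  have M: "?M \<in> carrier_mat (m + m') ((c + n) + c')" using A B B' by auto
  have AA: "0\<^sub>m m n @\<^sub>r A' \<in> carrier_mat (m + m') n" using A' by auto
  have join: "pair_join p q = (?M, 0\<^sub>m m n @\<^sub>r A')"
    using A B B' by (simp add: pair_join_def pp qq)
  have key: "(0\<^sub>m m n @\<^sub>r A') * (X + X') = ?M * ((Y @\<^sub>r X) @\<^sub>r Y') + (W @\<^sub>r W') * P \<longleftrightarrow>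
      A * X = B * Y + W * P \<and> A' * X' = B' * Y' + W' * P"
    if X: "X \<in> carrier_mat n k" and X': "X' \<in> carrier_mat n k"
      and Y: "Y \<in> carrier_mat c k" and Y': "Y' \<in> carrier_mat c' k"
      and W: "W \<in> carrier_mat m s" and W': "W' \<in> carrier_mat m' s" for X X' Y Y' W W'
  proof -
    have "?M * ((Y @\<^sub>r X) @\<^sub>r Y') = ((B @\<^sub>c - A) * (Y @\<^sub>r X) + 0\<^sub>m m c' * Y')
        @\<^sub>r ((0\<^sub>m m' c @\<^sub>c A') * (Y @\<^sub>r X) + B' * Y')"
      using A A' B B' X Y Y'
      by (intro four_block_mult_append_rows[where ?c1.0 = "c + n"]) auto
    also have "(B @\<^sub>c - A) * (Y @\<^sub>r X) = B * Y + (- A) * X"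
      using A B X Y by (intro append_cols_mult_append_rows) auto
    also have "(0\<^sub>m m' c @\<^sub>c A') * (Y @\<^sub>r X) = 0\<^sub>m m' c * Y + A' * X"
      using A' X Y by (intro append_cols_mult_append_rows) auto
    finally have "?M * ((Y @\<^sub>r X) @\<^sub>r Y') = (B * Y + (- A) * X) @\<^sub>r (A' * X + B' * Y')"
      using A A' B B' X Y Y' by simp
    then have 1: "?M * ((Y @\<^sub>r X) @\<^sub>r Y') + (W @\<^sub>r W') * P =
        (B * Y + (- A) * X + W * P) @\<^sub>r (A' * X + B' * Y' + W' * P)"
      using A A' X B B' Y Y' W W' P append_rows_mult[OF W W' P]
        add_append_rows[of "B * Y + (- A) * X" m k "W * P" "A' * X + B' * Y'" m' "W' * P"] by auto
    have 2: "(0\<^sub>m m n @\<^sub>r A') * (X + X') = 0\<^sub>m m k @\<^sub>r (A' * X + A' * X')"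
      using X X' A' append_rows_mult[of "0\<^sub>m m n" m n A' m' "X + X'" k]
        mult_add_distrib_mat[OF A' X X'] by auto
    have 3: "(0\<^sub>m m n @\<^sub>r A') * (X + X') = ?M * ((Y @\<^sub>r X) @\<^sub>r Y') + (W @\<^sub>r W') * P \<longleftrightarrow>
      0\<^sub>m m k = B * Y + (- A) * X + W * P \<and> A' * X + A' * X' = A' * X + B' * Y' + W' * P"
      unfolding 1 2 using A A' B B' X X' Y Y' W W' P
      by (intro append_rows_eq_iff[of _ m k _ _ m']) auto
    have 4: "0\<^sub>m m k = B * Y + (- A) * X + W * P \<longleftrightarrow> A * X = B * Y + W * P"
      using A B X Y W P
      by (auto simp: mat_eq_iff algebra_simps eq_neg_iff_add_eq_0)
    have 5: "A' * X + A' * X' = A' * X + B' * Y' + W' * P \<longleftrightarrow> A' * X' = B' * Y' + W' * P"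
      using A' B' X X' Y' W' P by (auto simp: mat_eq_iff algebra_simps)
    show ?thesis unfolding 3 4 5 ..
  qed
  show ?thesis
  proof (intro equalityI subsetI)
    fix X assume "X \<in> solutions (pair_join p q) P"
    then obtain YY WW where X: "X \<in> carrier_mat n k" and YY: "YY \<in> carrier_mat ((c + n) + c') k"
      and WW: "WW \<in> carrier_mat (m + m') s" and e: "(0\<^sub>m m n @\<^sub>r A') * X = ?M * YY + WW * P"
      unfolding join solutions_eq[OF M AA P] by blast
    obtain YX Y' where YX: "YX \<in> carrier_mat (c + n) k" "Y' \<in> carrier_mat c' k" "YY = YX @\<^sub>r Y'"
      using YY by (rule append_rows_cases)
    obtain Y X1 where Y: "Y \<in> carrier_mat c k" "X1 \<in> carrier_mat n k" "YX = Y @\<^sub>r X1"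
      using YX(1) by (rule append_rows_cases)
    obtain W W' where W: "W \<in> carrier_mat m s" "W' \<in> carrier_mat m' s" "WW = W @\<^sub>r W'"
      using WW by (rule append_rows_cases)
    have d: "X - X1 \<in> carrier_mat n k" using X Y by auto
    have X_eq: "X = X1 + (X - X1)" using X Y by (intro eq_matI) auto
    then have "A * X1 = B * Y + W * P \<and> A' * (X - X1) = B' * Y' + W' * P"
      using key[OF Y(2) d Y(1) YX(2) W(1,2)] e unfolding YX(3) Y(3) W(3) by simp
    then have "X1 \<in> solutions p P" "X - X1 \<in> solutions q P"
      using Y YX W d
      unfolding pp qq solutions_eq[OF B A P] solutions_eq[OF B' A' P] by blast+
    then show "X \<in> {X + X' | X X'. X \<in> solutions p P \<and> X' \<in> solutions q P}"
      using X_eq by blast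
  next
    fix Z assume "Z \<in> {X + X' | X X'. X \<in> solutions p P \<and> X' \<in> solutions q P}"
    then obtain X X' Y Y' W W' where *: "Z = X + X'" "X \<in> carrier_mat n k" "X' \<in> carrier_mat n k"
      "Y \<in> carrier_mat c k" "Y' \<in> carrier_mat c' k"
      "W \<in> carrier_mat m s" "W' \<in> carrier_mat m' s"
      "A * X = B * Y + W * P" "A' * X' = B' * Y' + W' * P"
      unfolding pp qq solutions_eq[OF B A P] solutions_eq[OF B' A' P] by blast
    then have "(0\<^sub>m m n @\<^sub>r A') * Z = ?M * ((Y @\<^sub>r X) @\<^sub>r Y') + (W @\<^sub>r W') * P"
      using key by simp
    moreover have "Z \<in> carrier_mat n k" "(Y @\<^sub>r X) @\<^sub>r Y' \<in> carrier_mat ((c + n) + c') k"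
      "W @\<^sub>r W' \<in> carrier_mat (m + m') s" using * by auto
    ultimately show "Z \<in> solutions (pair_join p q) P"
      unfolding join solutions_eq[OF M AA P] by blast
  qed
qed

section \<open>Bounds and the modular law\<close>

lemma pair_meet_greatest_lower_bound:
  assumes "p \<in> mat_pairs n" "q \<in> mat_pairs n" "r \<in> mat_pairs n"
  shows "mat_pair_le n r (pair_meet p q) \<longleftrightarrow> mat_pair_le n r p \<and> mat_pair_le n r q"
  using assms by (auto simp: mat_pair_le_iff_solutions solutions_meet)

lemma pair_join_least_upper_bound:
  assumes p: "p \<in> mat_pairs n" and q: "q \<in> mat_pairs n" and r: "r \<in> mat_pairs n"
  shows "mat_pair_le n (pair_join p q) r \<longleftrightarrow> mat_pair_le n p r \<and> mat_pair_le n q r"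
proof -
  have "solutions (pair_join p q) P \<subseteq> solutions r P \<longleftrightarrow>
      solutions p P \<subseteq> solutions r P \<and> solutions q P \<subseteq> solutions r P" for P
  proof (intro iffI conjI subsetI)
    fix X assume sub: "solutions (pair_join p q) P \<subseteq> solutions r P"
    {
      assume X: "X \<in> solutions p P"
      then have "X + 0\<^sub>m n (dim_col P) \<in> solutions (pair_join p q) P"
        unfolding solutions_join[OF p q] using zero_in_solutions[OF q] by blast
      then show "X \<in> solutions r P"
        using sub solutions_carrier[OF p X] by auto
    next
      assume X: "X \<in> solutions q P"
      then have "0\<^sub>m n (dim_col P) + X \<in> solutions (pair_join p q) P"
        unfolding solutions_join[OF p q] using zero_in_solutions[OF p] by blast
      then show "X \<in> solutions r P"
        using sub solutions_carrier[OF q X] by auto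
    }
  next
    fix X assume "solutions p P \<subseteq> solutions r P \<and> solutions q P \<subseteq> solutions r P"
      and "X \<in> solutions (pair_join p q) P"
    then show "X \<in> solutions r P"
      unfolding solutions_join[OF p q] using solutions_add[OF r] by blast
  qed
  then show ?thesis
    using assms by (auto simp: mat_pair_le_iff_solutions)
qed

text \<open>
  The modular law for subgroups: in a sum \<open>x + x'\<close> with \<open>x\<close> solving \<open>p\<close>, and hence \<open>q\<close>, the sum
  solves \<open>q\<close> if and only if \<open>x'\<close> does.
\<close>
lemma solutions_modular:
  assumes p: "p \<in> mat_pairs n" and q: "q \<in> mat_pairs n" and r: "r \<in> mat_pairs n"
    and le: "mat_pair_le n p q"
  shows "solutions (pair_meet (pair_join p r) q) P = solutions (pair_join p (pair_meet q r)) P"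
proof -
  have sub: "solutions p P \<subseteq> solutions q P"
    using le p q by (simp add: mat_pair_le_iff_solutions)
  have in_q: "X' \<in> solutions q P \<longleftrightarrow> X + X' \<in> solutions q P"
    if X: "X \<in> solutions p P" and X': "X' \<in> solutions r P" for X X'
  proof
    assume "X + X' \<in> solutions q P"
    then have "(X + X') - X \<in> solutions q P"
      using sub X by (intro solutions_diff[OF q]) auto
    moreover have "(X + X') - X = X'"
      using solutions_carrier[OF p X] solutions_carrier[OF r X'] by (intro eq_matI) auto
    ultimately show "X' \<in> solutions q P" by simp
  qed (use sub X solutions_add[OF q] in blast)
  have "solutions (pair_meet (pair_join p r) q) P =
      {X + X' | X X'. X \<in> solutions p P \<and> X' \<in> solutions r P \<and> X + X' \<in> solutions q P}"
    using p q r by (auto simp: solutions_meet[of _ n] solutions_join[of _ n])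
  also have "\<dots> = {X + X' | X X'. X \<in> solutions p P \<and> X' \<in> solutions q P \<inter> solutions r P}"
    using in_q by auto
  also have "\<dots> = solutions (pair_join p (pair_meet q r)) P"
    using p q r by (simp add: solutions_meet[of _ n] solutions_join[of _ n])
  finally show ?thesis .
qed

section \<open>The lattice of equivalence classes\<close>

definition pair_class ::
    "nat \<Rightarrow> 'a :: {ring, monoid_mult} mat \<times> 'a mat \<Rightarrow> ('a mat \<times> 'a mat) set" where
  "pair_class n p = mat_pair_equiv n `` {p}"

lemma equiv_mat_pair_equiv: "equiv (mat_pairs n) (mat_pair_equiv n)"
  by (rule equivI)
    (auto simp: mat_pair_equiv_def mat_pair_le_iff_solutions refl_on_def sym_def trans_def, blast+)

lemma carrier_mat_pair_order: "carrier (mat_pair_order n) = pair_class n ` mat_pairs n"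
  by (auto simp: mat_pair_order_def quotient_def pair_class_def)

text \<open>
  The order on classes asks for some pair of comparable representatives; as the relation is
  transitive, every choice of representatives gives the same answer.
\<close>
lemma le_pair_class:
  assumes p: "p \<in> mat_pairs n" and q: "q \<in> mat_pairs n"
  shows "pair_class n p \<sqsubseteq>\<^bsub>mat_pair_order n\<^esub> pair_class n q \<longleftrightarrow> mat_pair_le n p q"
proof
  assume "mat_pair_le n p q"
  moreover have "p \<in> pair_class n p" "q \<in> pair_class n q"
    using equiv_class_self[OF equiv_mat_pair_equiv p] equiv_class_self[OF equiv_mat_pair_equiv q]
    by (simp_all add: pair_class_def)
  ultimately show "pair_class n p \<sqsubseteq>\<^bsub>mat_pair_order n\<^esub> pair_class n q"
    by (auto simp: mat_pair_order_def)
next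
  assume "pair_class n p \<sqsubseteq>\<^bsub>mat_pair_order n\<^esub> pair_class n q"
  then obtain p' q' where "(p, p') \<in> mat_pair_equiv n" "(q, q') \<in> mat_pair_equiv n" "mat_pair_le n p' q'"
    by (auto simp: mat_pair_order_def pair_class_def)
  then show "mat_pair_le n p q"
    by (auto simp: mat_pair_equiv_def mat_pair_le_iff_solutions) blast
qed

lemma pair_class_eq_iff:
  assumes "p \<in> mat_pairs n" "q \<in> mat_pairs n"
  shows "pair_class n p = pair_class n q \<longleftrightarrow> mat_pair_le n p q \<and> mat_pair_le n q p"
  unfolding pair_class_def eq_equiv_class_iff[OF equiv_mat_pair_equiv assms]
  using assms by (simp add: mat_pair_equiv_def)

lemma partial_order_mat_pair_order:
  "partial_order (mat_pair_order n :: ('a :: {ring, monoid_mult} mat \<times> 'a mat) set gorder)"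
proof -
  let ?L = "mat_pair_order n :: ('a mat \<times> 'a mat) set gorder"
  have eq: "(.=\<^bsub>?L\<^esub>) = (=)"
    by (simp add: mat_pair_order_def)
  have refl: "x \<sqsubseteq>\<^bsub>?L\<^esub> x" if "x \<in> carrier ?L" for x
    using that unfolding carrier_mat_pair_order
    by (elim imageE) (simp add: le_pair_class mat_pair_le_iff_solutions)
  have antisym: "x = y"
    if "x \<sqsubseteq>\<^bsub>?L\<^esub> y" "y \<sqsubseteq>\<^bsub>?L\<^esub> x" "x \<in> carrier ?L" "y \<in> carrier ?L" for x y
    using that unfolding carrier_mat_pair_order
    by (elim imageE) (simp add: le_pair_class pair_class_eq_iff)
  have trans: "x \<sqsubseteq>\<^bsub>?L\<^esub> z"
    if "x \<sqsubseteq>\<^bsub>?L\<^esub> y" "y \<sqsubseteq>\<^bsub>?L\<^esub> z" "x \<in> carrier ?L" "y \<in> carrier ?L" "z \<in> carrier ?L" for x y z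
    using that unfolding carrier_mat_pair_order
    by (elim imageE) (simp add: le_pair_class mat_pair_le_iff_solutions, blast)
  show ?thesis
  proof
    fix x y assume "x \<sqsubseteq>\<^bsub>?L\<^esub> y" "y \<sqsubseteq>\<^bsub>?L\<^esub> x" "x \<in> carrier ?L" "y \<in> carrier ?L"
    then show "x .=\<^bsub>?L\<^esub> y" unfolding eq by (rule antisym)
  next
    fix x y z
    assume "x \<sqsubseteq>\<^bsub>?L\<^esub> y" "y \<sqsubseteq>\<^bsub>?L\<^esub> z" "x \<in> carrier ?L" "y \<in> carrier ?L" "z \<in> carrier ?L"
    then show "x \<sqsubseteq>\<^bsub>?L\<^esub> z" by (rule trans)
  qed (simp_all add: eq refl)
qed

lemma least_pair_join:
  fixes p q :: "'a :: {ring, monoid_mult} mat \<times> 'a mat"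
  assumes p: "p \<in> mat_pairs n" and q: "q \<in> mat_pairs n"
  shows "least (mat_pair_order n) (pair_class n (pair_join p q))
    (Upper (mat_pair_order n) {pair_class n p, pair_class n q})"
proof -
  let ?L = "mat_pair_order n :: ('a mat \<times> 'a mat) set gorder"
  interpret partial_order ?L by (rule partial_order_mat_pair_order)
  have "mat_pair_le n (pair_join p q) (pair_join p q)"
    using p q by (simp add: mat_pair_le_iff_solutions)
  then have upper: "mat_pair_le n p (pair_join p q)" "mat_pair_le n q (pair_join p q)"
    using pair_join_least_upper_bound[OF p q pair_join_in[OF p q]] by auto
  have carr: "pair_class n r \<in> carrier ?L" if "r \<in> mat_pairs n" for r :: "'a mat \<times> 'a mat"
    using that by (simp add: carrier_mat_pair_order)
  show ?thesis
  proof (rule least_UpperI)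
    fix x assume "x \<in> {pair_class n p, pair_class n q}"
    then show "x \<sqsubseteq>\<^bsub>?L\<^esub> pair_class n (pair_join p q)"
      using upper p q by (elim insertE) (simp_all add: le_pair_class)
  next
    fix y assume y: "y \<in> Upper ?L {pair_class n p, pair_class n q}"
    then have "y \<in> carrier ?L"
      by (simp add: Upper_def)
    then obtain r where "r \<in> mat_pairs n" "y = pair_class n r"
      unfolding carrier_mat_pair_order by blast
    moreover from y have "pair_class n p \<sqsubseteq>\<^bsub>?L\<^esub> y"
      "pair_class n q \<sqsubseteq>\<^bsub>?L\<^esub> y"
      using carr p q by (simp_all add: Upper_def)
    ultimately show "pair_class n (pair_join p q) \<sqsubseteq>\<^bsub>?L\<^esub> y"
      using p q by (simp add: le_pair_class pair_join_least_upper_bound)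
  qed (use carr p q in auto)
qed

lemma greatest_pair_meet:
  fixes p q :: "'a :: {ring, monoid_mult} mat \<times> 'a mat"
  assumes p: "p \<in> mat_pairs n" and q: "q \<in> mat_pairs n"
  shows "greatest (mat_pair_order n) (pair_class n (pair_meet p q))
    (Lower (mat_pair_order n) {pair_class n p, pair_class n q})"
proof -
  let ?L = "mat_pair_order n :: ('a mat \<times> 'a mat) set gorder"
  interpret partial_order ?L by (rule partial_order_mat_pair_order)
  have "mat_pair_le n (pair_meet p q) (pair_meet p q)"
    using p q by (simp add: mat_pair_le_iff_solutions)
  then have lower: "mat_pair_le n (pair_meet p q) p" "mat_pair_le n (pair_meet p q) q"
    using pair_meet_greatest_lower_bound[OF p q pair_meet_in[OF p q]] by auto
  have carr: "pair_class n r \<in> carrier ?L" if "r \<in> mat_pairs n" for r :: "'a mat \<times> 'a mat"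
    using that by (simp add: carrier_mat_pair_order)
  show ?thesis
  proof (rule greatest_LowerI)
    fix x assume "x \<in> {pair_class n p, pair_class n q}"
    then show "pair_class n (pair_meet p q) \<sqsubseteq>\<^bsub>?L\<^esub> x"
      using lower p q by (elim insertE) (simp_all add: le_pair_class)
  next
    fix y assume y: "y \<in> Lower ?L {pair_class n p, pair_class n q}"
    then have "y \<in> carrier ?L"
      by (simp add: Lower_def)
    then obtain r where "r \<in> mat_pairs n" "y = pair_class n r"
      unfolding carrier_mat_pair_order by blast
    moreover from y have "y \<sqsubseteq>\<^bsub>?L\<^esub> pair_class n p"
      "y \<sqsubseteq>\<^bsub>?L\<^esub> pair_class n q"
      using carr p q by (simp_all add: Lower_def)
    ultimately show "y \<sqsubseteq>\<^bsub>?L\<^esub> pair_class n (pair_meet p q)"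
      using p q by (simp add: le_pair_class pair_meet_greatest_lower_bound)
  qed (use carr p q in auto)
qed

lemma lattice_mat_pair_order:
  "Lattice.lattice (mat_pair_order n :: ('a :: {ring, monoid_mult} mat \<times> 'a mat) set gorder)"
proof -
  interpret partial_order "mat_pair_order n :: ('a mat \<times> 'a mat) set gorder"
    by (rule partial_order_mat_pair_order)
  show ?thesis
    by unfold_locales
      (auto simp: carrier_mat_pair_order intro: least_pair_join greatest_pair_meet)
qed

lemma join_pair_class:
  fixes p q :: "'a :: {ring, monoid_mult} mat \<times> 'a mat"
  assumes "p \<in> mat_pairs n" "q \<in> mat_pairs n"
  shows "pair_class n p \<squnion>\<^bsub>mat_pair_order n\<^esub> pair_class n q = pair_class n (pair_join p q)"
proof -
  interpret Lattice.lattice "mat_pair_order n :: ('a mat \<times> 'a mat) set gorder"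
    by (rule lattice_mat_pair_order)
  have "least (mat_pair_order n) (pair_class n p \<squnion>\<^bsub>mat_pair_order n\<^esub> pair_class n q)
      (Upper (mat_pair_order n) {pair_class n p, pair_class n q})"
    unfolding join_def by (rule sup_of_two_least) (simp_all add: carrier_mat_pair_order assms)
  then show ?thesis
    using least_pair_join[OF assms] by (rule least_unique)
qed

lemma meet_pair_class:
  fixes p q :: "'a :: {ring, monoid_mult} mat \<times> 'a mat"
  assumes "p \<in> mat_pairs n" "q \<in> mat_pairs n"
  shows "pair_class n p \<sqinter>\<^bsub>mat_pair_order n\<^esub> pair_class n q = pair_class n (pair_meet p q)"
proof -
  interpret Lattice.lattice "mat_pair_order n :: ('a mat \<times> 'a mat) set gorder"
    by (rule lattice_mat_pair_order)
  have "greatest (mat_pair_order n) (pair_class n p \<sqinter>\<^bsub>mat_pair_order n\<^esub> pair_class n q)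
      (Lower (mat_pair_order n) {pair_class n p, pair_class n q})"
    unfolding meet_def by (rule inf_of_two_greatest) (simp_all add: carrier_mat_pair_order assms)
  then show ?thesis
    using greatest_pair_meet[OF assms] by (rule greatest_unique)
qed

theorem theorem16:
  fixes n :: nat
  assumes "n \<ge> 1"
  shows "modular_lattice (mat_pair_order n :: ('a :: {ring, monoid_mult} mat \<times> 'a mat) set gorder)
    \<and> Lattice.bounded_lattice (mat_pair_order n :: ('a mat \<times> 'a mat) set gorder)"
proof
  let ?L = "mat_pair_order n :: ('a mat \<times> 'a mat) set gorder"
  interpret Lattice.lattice ?L by (rule lattice_mat_pair_order)
  show "modular_lattice ?L"
  proof
    fix a b c assume "a \<in> carrier ?L" "b \<in> carrier ?L" "c \<in> carrier ?L" and le: "a \<sqsubseteq>\<^bsub>?L\<^esub> b"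
    then obtain p q r where "p \<in> mat_pairs n" "q \<in> mat_pairs n" "r \<in> mat_pairs n"
      and "a = pair_class n p" "b = pair_class n q" "c = pair_class n r"
      by (auto simp: carrier_mat_pair_order)
    with le show "(a \<squnion>\<^bsub>?L\<^esub> c) \<sqinter>\<^bsub>?L\<^esub> b = a \<squnion>\<^bsub>?L\<^esub> (b \<sqinter>\<^bsub>?L\<^esub> c)"
      using solutions_modular[of p n q r]
      by (simp add: le_pair_class join_pair_class meet_pair_class pair_class_eq_iff
          mat_pair_le_iff_solutions)
  qed
  show "Lattice.bounded_lattice ?L"
  proof
    have "pair_class n (pair_bot n) \<sqsubseteq>\<^bsub>?L\<^esub> pair_class n p"
      if "p \<in> mat_pairs n" for p :: "'a mat \<times> 'a mat"
      using that relations_in_solutions[OF that]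
      by (auto simp: le_pair_class mat_pair_le_iff_solutions solutions_bot)
    then have "least ?L (pair_class n (pair_bot n)) (carrier ?L)"
      by (auto simp: least_def carrier_mat_pair_order)
    then show "\<exists>x. least ?L x (carrier ?L)" ..
    have "pair_class n p \<sqsubseteq>\<^bsub>?L\<^esub> pair_class n (pair_top n)"
      if "p \<in> mat_pairs n" for p :: "'a mat \<times> 'a mat"
      using that solutions_carrier[OF that]
      by (auto simp: le_pair_class mat_pair_le_iff_solutions solutions_top)
    then have "greatest ?L (pair_class n (pair_top n)) (carrier ?L)"
      by (auto simp: greatest_def carrier_mat_pair_order)
    then show "\<exists>x. greatest ?L x (carrier ?L)" ..
  qed
qed

end
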